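(* For every while-program $S\in WP$ with program variables $\vec x$ and every model $M\models PA$, define the relation $\vec y=g_S^M(\vec x)$ by: for $\vec a,\vec b\in M$, $g_S^M(\vec a)=\vec b$ iff there are assignments $v,v'$ over $M$ with $v(\vec x)=\vec a$, $v'(\vec x)=\vec b$ and $(v,v')\in A_S^M$. Then $g_S^M$ is a (partial) function, and for all $\vec a,\vec b\in M$, $$g_S^M(\vec a)=\vec b\quad\text{iff}\quad M\models\alpha_S(\vec a,\vec b).$$
   Context: **Language.** $L$ is the first-order language with equality and signature $\{+,\cdot,<,0,1\}$ of Peano arithmetic $PA$. $M$ denotes both a model and its domain. All models considered are countable. An assignment over $M$ maps all variables to elements of $M$; $v(\vec a/\vec x)$ is the assignment equal to $v$ except that $\vec x$ is mapped to $\vec a$; $E^{M,v}$ is the value of the term $E$ at $v$. Operations and relations on vectors are componentwise. **Coding functions (definable in $PA$).** $\langle x,y\rangle=\lfloor (x+y+1)(x+y)/2\rfloor+y$, and $L(z),R(z)$ are its inverses: $L(\langle x,y\rangle)=x$, $R(\langle x,y\rangle)=y$, $\langle L(z),R(z)\rangle=z$. Put $\langle x_1,\dots,x_n\rangle=\langle x_1,\langle x_2,\dots,x_n\rangle\rangle$, and let $\overline z$ be the $n$-tuple coded by $z$ ($\overline z=z$ if $n=1$). The extended $\beta$-function $(x)_i$ is the remainder of $L(x)$ on division by $R(x)\cdot(i+1)+1$. **While-programs.** Expressions $E::=0\mid1\mid x\mid E_1+E_2\mid E_1\cdot E_2$; boolean expressions $B::=E_1<E_2\mid\neg B_1\mid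 B_1\to B_2$; programs $S::=x:=E\mid S_1;S_2\mid if\ B\ then\ S_1\ else\ S_2\ fi\mid while\ B\ do\ S_0\ od$. $WP$ is the set of all programs. $\vec x=(x_1,\dots,x_n)$ lists the program variables of $S$ (the formulas for subprograms of $S$ use the same vector $\vec x$). **Formulas.** For $\vec y=(y_1,\dots,y_n)$ disjoint from $\vec x$ define $\alpha_S(\vec x,\vec y)\in L$ by: for $x_i:=E$, $y_i=E(\vec x)\wedge\bigwedge_{j\ne i}y_j=x_j$; for $S_1;S_2$, $\exists\vec z(\alpha_{S_1}(\vec x,\vec z)\wedge\alpha_{S_2}(\vec z,\vec y))$; for the conditional, $(B(\vec x)\wedge\alpha_{S_1}(\vec x,\vec y))\vee(\neg B(\vec x)\wedge\alpha_{S_2}(\vec x,\vec y))$; for $S\equiv while\ B\ do\ S_0\ od$, $\exists i\,\alpha^*_S(i,\vec x,\vec y)\wedge\neg B(\vec y)$, where $\alpha_S^*(i,\vec x,\vec y)::=\exists w\big(\vec x=\overline{(w)_0}\wedge\forall j<i\,(B(\overline{(w)_j})\wedge\alpha_{S_0}(\overline{(w)_j},\overline{(w)_{j+1}}))\wedge\vec y=\overline{(w)_i}\big)$. Also $\varphi_{S_0}(\vec x,y,\vec z)::=\exists w\big(\overline{(w)_0}=\vec x\wedge\forall j<y\ \alpha_{S_0}(\overline{(w)_j},\overline{(w)_{j+1}})\wedge\overline{(w)_y}=\vec z\big)$. **X-semantics.** For $M\models PA$, the binary relation $A_S^M$ on assignments over $M$ is defined by: $(v,v')\in A^M_{x_i:=E}$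 iff $v'=v(E^{M,v}/x_i)$; $A^M_{S_1;S_2}$ is the relational composition ($A_{S_1}^M$ first, then $A_{S_2}^M$); $(v,v')\in A^M_{if\,B\,then\,S_1\,else\,S_2\,fi}$ iff ($M,v\models B$ and $(v,v')\in A_{S_1}^M$) or ($M,v\not\models B$ and $(v,v')\in A_{S_2}^M$); and $(v,v')\in A^M_{while\,B\,do\,S_0\,od}$ iff there are $i\in M$ and $\vec x_0,\dots,\vec x_i\in M$ (indexed by all $j\le i$ in $M$) such that $M\models\varphi_{S_0}(v(\vec x),j,\vec x_j)$ for all $j\le i$, $v(\vec x)=\vec x_0$, for all $j<i$: $M,v(\vec x_j/\vec x)\models B$ and $(v(\vec x_j/\vec x),v(\vec x_{j+1}/\vec x))\in A_{S_0}^M$, and $v'=v(\vec x_i/\vec x)$, $M,v'\not\models B$. *)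

theory Defs
  imports "HOL-Library.Countable_Set"
begin

text \<open>The terms serve also as the expressions of while-programs.\<close>

datatype (vars_tm: 'v) tm =
    TZero | TOne | TVar 'v | TAdd "'v tm" "'v tm" | TMul "'v tm" "'v tm"
  for map: rename_tm

datatype fm =
    Eq "nat tm" "nat tm"
  | Lt "nat tm" "nat tm"
  | Neg fm
  | And fm fm
  | Or fm fm
  | Imp fm fm
  | Forall nat fm
  | Exists nat fm

definition Iff :: "fm \<Rightarrow> fm \<Rightarrow> fm" where
  "Iff \<phi> \<psi> = And (Imp \<phi> \<psi>) (Imp \<psi> \<phi>)"

definition Conj :: "fm list \<Rightarrow> fm" where
  "Conj \<phi>s = foldr And \<phi>s (Eq TZero TZero)"

definition Exists_list :: "nat list \<Rightarrow> fm \<Rightarrow> fm" where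
  "Exists_list xs \<phi> = foldr Exists xs \<phi>"

definition Forall_less :: "nat \<Rightarrow> nat tm \<Rightarrow> fm \<Rightarrow> fm" where
  "Forall_less j t \<phi> = Forall j (Imp (Lt (TVar j) t) \<phi>)"

text \<open>The domain of a structure is the whole type \<open>'a\<close>.\<close>

record 'a lstruct =
  zer :: 'a
  uno :: 'a
  pls :: "'a \<Rightarrow> 'a \<Rightarrow> 'a"
  tms :: "'a \<Rightarrow> 'a \<Rightarrow> 'a"
  lss :: "'a \<Rightarrow> 'a \<Rightarrow> bool"

primrec tval :: "'a lstruct \<Rightarrow> (nat \<Rightarrow> 'a) \<Rightarrow> nat tm \<Rightarrow> 'a" where
  "tval M v TZero = zer M"
| "tval M v TOne = uno M"
| "tval M v (TVar x) = v x"
| "tval M v (TAdd s t) = pls M (tval M v s) (tval M v t)"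
| "tval M v (TMul s t) = tms M (tval M v s) (tval M v t)"

primrec sat :: "'a lstruct \<Rightarrow> (nat \<Rightarrow> 'a) \<Rightarrow> fm \<Rightarrow> bool" where
  "sat M v (Eq s t) \<longleftrightarrow> tval M v s = tval M v t"
| "sat M v (Lt s t) \<longleftrightarrow> lss M (tval M v s) (tval M v t)"
| "sat M v (Neg \<phi>) \<longleftrightarrow> \<not> sat M v \<phi>"
| "sat M v (And \<phi> \<psi>) \<longleftrightarrow> sat M v \<phi> \<and> sat M v \<psi>"
| "sat M v (Or \<phi> \<psi>) \<longleftrightarrow> sat M v \<phi> \<or> sat M v \<psi>"
| "sat M v (Imp \<phi> \<psi>) \<longleftrightarrow> (sat M v \<phi> \<longrightarrow> sat M v \<psi>)"
| "sat M v (Forall x \<phi>) \<longleftrightarrow> (\<forall>a. sat M (v(x := a)) \<phi>)"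
| "sat M v (Exists x \<phi>) \<longleftrightarrow> (\<exists>a. sat M (v(x := a)) \<phi>)"

text \<open>Simultaneous update; for a list \<open>xs\<close> of distinct variables, \<open>upds v xs as\<close> is
  \<open>v(as/xs)\<close>, and \<open>upds id xs us\<close> is the renaming of \<open>xs\<close> to \<open>us\<close>.\<close>

definition upds :: "('b \<Rightarrow> 'c) \<Rightarrow> 'b list \<Rightarrow> 'c list \<Rightarrow> 'b \<Rightarrow> 'c" where
  "upds f xs as = (\<lambda>x. case map_of (zip xs as) x of None \<Rightarrow> f x | Some a \<Rightarrow> a)"

text \<open>\<open>M \<Turnstile> \<phi>(as)\<close>, where the free variables of \<open>\<phi>\<close> are among the distinct variables \<open>zs\<close>.\<close>

definition holds :: "'a lstruct \<Rightarrow> fm \<Rightarrow> nat list \<Rightarrow> 'a list \<Rightarrow> bool" where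
  "holds M \<phi> zs as \<longleftrightarrow> (\<forall>v. sat M (upds v zs as) \<phi>)"

primrec subst_tm :: "nat \<Rightarrow> nat tm \<Rightarrow> nat tm \<Rightarrow> nat tm" where
  "subst_tm x t TZero = TZero"
| "subst_tm x t TOne = TOne"
| "subst_tm x t (TVar y) = (if y = x then t else TVar y)"
| "subst_tm x t (TAdd r s) = TAdd (subst_tm x t r) (subst_tm x t s)"
| "subst_tm x t (TMul r s) = TMul (subst_tm x t r) (subst_tm x t s)"

text \<open>Bound variables are not renamed. In the induction axioms \<open>t\<close> contains no variable other
  than \<open>x\<close>, so no capture can occur.\<close>

primrec subst_fm :: "nat \<Rightarrow> nat tm \<Rightarrow> fm \<Rightarrow> fm" where
  "subst_fm x t (Eq r s) = Eq (subst_tm x t r) (subst_tm x t s)"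
| "subst_fm x t (Lt r s) = Lt (subst_tm x t r) (subst_tm x t s)"
| "subst_fm x t (Neg \<phi>) = Neg (subst_fm x t \<phi>)"
| "subst_fm x t (And \<phi> \<psi>) = And (subst_fm x t \<phi>) (subst_fm x t \<psi>)"
| "subst_fm x t (Or \<phi> \<psi>) = Or (subst_fm x t \<phi>) (subst_fm x t \<psi>)"
| "subst_fm x t (Imp \<phi> \<psi>) = Imp (subst_fm x t \<phi>) (subst_fm x t \<psi>)"
| "subst_fm x t (Forall y \<phi>) = Forall y (if y = x then \<phi> else subst_fm x t \<phi>)"
| "subst_fm x t (Exists y \<phi>) = Exists y (if y = x then \<phi> else subst_fm x t \<phi>)"

definition induction_axiom :: "nat \<Rightarrow> fm \<Rightarrow> fm" where
  "induction_axiom x \<phi> =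
     Imp (And (subst_fm x TZero \<phi>)
              (Forall x (Imp \<phi> (subst_fm x (TAdd (TVar x) TOne) \<phi>))))
         (Forall x \<phi>)"

text \<open>The axioms are open formulas; \<open>M \<Turnstile> PA\<close> requires them under all assignments.\<close>

definition PA :: "fm set" where
  "PA = (let x = TVar 0; y = TVar 1; z = TVar 2 in
     {Neg (Eq (TAdd x TOne) TZero),
      Imp (Eq (TAdd x TOne) (TAdd y TOne)) (Eq x y),
      Eq (TAdd x TZero) x,
      Eq (TAdd x (TAdd y TOne)) (TAdd (TAdd x y) TOne),
      Eq (TMul x TZero) TZero,
      Eq (TMul x (TAdd y TOne)) (TAdd (TMul x y) x),
      Iff (Lt x y) (Exists 2 (Eq (TAdd x (TAdd z TOne)) y))}
     \<union> {induction_axiom u \<phi> | u \<phi>. True})"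

definition models_PA :: "'a lstruct \<Rightarrow> bool" where
  "models_PA M \<longleftrightarrow> (\<forall>\<phi>\<in>PA. \<forall>v. sat M v \<phi>)"

datatype (vars_bexp: 'v) bexp =
    BLess "'v tm" "'v tm" | BNeg "'v bexp" | BImp "'v bexp" "'v bexp"
  for map: rename_bexp

datatype (vars_prog: 'v) prog =
    Assign 'v "'v tm"
  | Comp "'v prog" "'v prog"
  | Cond "'v bexp" "'v prog" "'v prog"
  | While "'v bexp" "'v prog"

primrec fm_of_bexp :: "nat bexp \<Rightarrow> fm" where
  "fm_of_bexp (BLess s t) = Lt s t"
| "fm_of_bexp (BNeg b) = Neg (fm_of_bexp b)"
| "fm_of_bexp (BImp b c) = Imp (fm_of_bexp b) (fm_of_bexp c)"

definition fresh_var :: "nat set \<Rightarrow> nat" where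
  "fresh_var A = Suc (Max (insert 0 A))"

definition fresh_vars :: "nat \<Rightarrow> nat set \<Rightarrow> nat list" where
  "fresh_vars n A = [fresh_var A..<fresh_var A + n]"

text \<open>\<open>\<langle>s,t\<rangle> = u\<close>; the bound variable \<open>q\<close> is the rounded-down half of \<open>(s + t + 1)(s + t)\<close>.\<close>

definition pair_fm :: "nat tm \<Rightarrow> nat tm \<Rightarrow> nat tm \<Rightarrow> fm" where
  "pair_fm s t u =
     (let q = fresh_var (vars_tm s \<union> vars_tm t \<union> vars_tm u);
          d = TAdd (TVar q) (TVar q);
          p = TMul (TAdd (TAdd s t) TOne) (TAdd s t)
      in Exists q (And (Or (Eq d p) (Eq (TAdd d TOne) p)) (Eq (TAdd (TVar q) t) u)))"

text \<open>\<open>\<langle>u\<^sub>1,\<dots>,u\<^sub>n\<rangle> = t\<close>, that is, \<open>(u\<^sub>1,\<dots>,u\<^sub>n)\<close> is the \<open>n\<close>-tuple coded by \<open>t\<close>, for \<open>n \<ge> 1\<close>.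
  The equation for the empty list is arbitrary: every program has a variable.\<close>

fun tuple_fm :: "nat list \<Rightarrow> nat tm \<Rightarrow> fm" where
  "tuple_fm [] t = Eq TZero TZero"
| "tuple_fm [u] t = Eq (TVar u) t"
| "tuple_fm (u # u' # us) t =
     (let s = fresh_var (set (u # u' # us) \<union> vars_tm t)
      in Exists s (And (pair_fm (TVar u) (TVar s) t) (tuple_fm (u' # us) (TVar s))))"

text \<open>\<open>(w)\<^sub>t = c\<close>, i.e. \<open>c\<close> is the remainder of \<open>l = L(w)\<close> modulo \<open>r(t + 1) + 1\<close>, \<open>r = R(w)\<close>.\<close>

definition beta_fm :: "nat \<Rightarrow> nat tm \<Rightarrow> nat \<Rightarrow> fm" where
  "beta_fm w t c =
     (let k = fresh_var ({w, c} \<union> vars_tm t); l = k; r = k + 1; q = k + 2;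
          m = TAdd (TMul (TVar r) (TAdd t TOne)) TOne
      in Exists l (Exists r (And (pair_fm (TVar l) (TVar r) (TVar w))
           (Exists q (And (Eq (TVar l) (TAdd (TMul (TVar q) m) (TVar c)))
                          (Lt (TVar c) m))))))"

text \<open>The vector \<open>us\<close> is the tuple coded by \<open>(w)\<^sub>t\<close>.\<close>

definition entry_fm :: "nat \<Rightarrow> nat tm \<Rightarrow> nat list \<Rightarrow> fm" where
  "entry_fm w t us =
     (let c = fresh_var ({w} \<union> vars_tm t \<union> set us)
      in Exists c (And (beta_fm w t c) (tuple_fm us (TVar c))))"

text \<open>For a formula \<open>\<sigma> ps qs\<close> in the vectors of variables \<open>ps\<close> and \<open>qs\<close>: some \<open>w\<close> codes a
  sequence of \<open>n\<close>-tuples which starts with \<open>us\<close>, has \<open>ws\<close> at position \<open>i\<close>, and any two successive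
  entries up to there satisfy \<open>\<sigma>\<close>. The existentially quantified vectors \<open>ps\<close> and \<open>qs\<close> eliminate
  the function terms from \<open>\<sigma>\<close> applied to entries \<open>j\<close> and \<open>j + 1\<close>.\<close>

definition seq_fm :: "(nat list \<Rightarrow> nat list \<Rightarrow> fm) \<Rightarrow> nat list \<Rightarrow> nat \<Rightarrow> nat list \<Rightarrow> fm" where
  "seq_fm \<sigma> us i ws =
     (let n = length us;
          w = fresh_var (set us \<union> {i} \<union> set ws);
          j = w + 1;
          ps = [w + 2..<w + 2 + n];
          qs = [w + 2 + n..<w + 2 + 2 * n]
      in Exists w
          (And (entry_fm w TZero us)
          (And (Forall_less j (TVar i)
                 (Exists_list ps (Exists_list qs
                   (And (entry_fm w (TVar j) ps)
                   (And (entry_fm w (TAdd (TVar j) TOne) qs)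
                        (\<sigma> ps qs))))))
               (entry_fm w (TVar i) ws))))"

text \<open>\<open>alpha xs S us ws\<close> is the formula \<open>\<alpha>\<^sub>S(us,ws)\<close> for the vector \<open>xs\<close> of program variables;
  instances for different vectors of variables are formed directly, with suitable bound
  variables, rather than by substitution into \<open>\<alpha>\<^sub>S(xs,ys)\<close>.\<close>

primrec alpha :: "nat list \<Rightarrow> nat prog \<Rightarrow> nat list \<Rightarrow> nat list \<Rightarrow> fm" where
  "alpha xs (Assign x E) = (\<lambda>us ws.
     Conj (map (\<lambda>(z, u, w). Eq (TVar w) (if z = x then rename_tm (upds id xs us) E else TVar u))
               (zip xs (zip us ws))))"
| "alpha xs (Comp S1 S2) = (\<lambda>us ws.
     let zs = fresh_vars (length xs) (set us \<union> set ws)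
     in Exists_list zs (And (alpha xs S1 us zs) (alpha xs S2 zs ws)))"
| "alpha xs (Cond B S1 S2) = (\<lambda>us ws.
     let b = fm_of_bexp (rename_bexp (upds id xs us) B)
     in Or (And b (alpha xs S1 us ws)) (And (Neg b) (alpha xs S2 us ws)))"
| "alpha xs (While B S0) = (\<lambda>us ws.
     let i = fresh_var (set us \<union> set ws);
         b = (\<lambda>ps. fm_of_bexp (rename_bexp (upds id xs ps) B))
     in And (Exists i (seq_fm (\<lambda>ps qs. And (b ps) (alpha xs S0 ps qs)) us i ws))
            (Neg (b ws)))"

definition phi :: "nat list \<Rightarrow> nat prog \<Rightarrow> nat list \<Rightarrow> nat \<Rightarrow> nat list \<Rightarrow> fm" where
  "phi xs S0 us y zs = seq_fm (alpha xs S0) us y zs"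

text \<open>In the last clause \<open>X\<close> is the family of vectors \<open>x\<^sub>j\<close>; only its values at \<open>j \<le> i\<close> matter.\<close>

primrec xsem :: "'a lstruct \<Rightarrow> nat list \<Rightarrow> nat prog \<Rightarrow> ((nat \<Rightarrow> 'a) \<times> (nat \<Rightarrow> 'a)) set" where
  "xsem M xs (Assign x E) = {(v, v'). v' = v(x := tval M v E)}"
| "xsem M xs (Comp S1 S2) = xsem M xs S1 O xsem M xs S2"
| "xsem M xs (Cond B S1 S2) =
     {(v, v'). sat M v (fm_of_bexp B) \<and> (v, v') \<in> xsem M xs S1
             \<or> \<not> sat M v (fm_of_bexp B) \<and> (v, v') \<in> xsem M xs S2}"
| "xsem M xs (While B S0) =
     {(v, v'). \<exists>i X.
        (\<forall>j. lss M j i \<or> j = i \<longrightarrow>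
           length (X j) = length xs \<and>
           (let y = fresh_var (set xs); zs = fresh_vars (length xs) (insert y (set xs))
            in holds M (phi xs S0 xs y zs) (xs @ [y] @ zs) (map v xs @ [j] @ X j))) \<and>
        map v xs = X (zer M) \<and>
        (\<forall>j. lss M j i \<longrightarrow>
           sat M (upds v xs (X j)) (fm_of_bexp B) \<and>
           (upds v xs (X j), upds v xs (X (pls M j (uno M)))) \<in> xsem M xs S0) \<and>
        v' = upds v xs (X i) \<and>
        \<not> sat M v' (fm_of_bexp B)}"

definition g_rel :: "'a lstruct \<Rightarrow> nat list \<Rightarrow> nat prog \<Rightarrow> 'a list \<Rightarrow> 'a list \<Rightarrow> bool" where
  "g_rel M xs S as bs \<longleftrightarrow>
     (\<exists>v v'. map v xs = as \<and> map v' xs = bs \<and> (v, v') \<in> xsem M xs S)"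

end

theory Submission imports Defs begin

text \<open>The formula \<open>\<alpha>\<^sub>S\<close> defines in \<open>M\<close> a relation between vectors that does not depend on the
  variables chosen to write it down, and the claim follows by induction on \<open>S\<close> from the fact that
  this relation is functional and describes the X-semantics. The only case of substance is the loop.
  There the code \<open>w\<close> given by \<open>\<phi>\<close> at the last index \<open>i\<close> already witnesses \<open>\<alpha>\<^sub>S\<close>: its entries agree
  with the vectors \<open>x\<^sub>j\<close> of the X-semantics, because two codes of computations of the same functional
  relation with the same start agree, by induction in \<open>M\<close>. Hence no new codes have to be
  constructed. Of the coding functions only uniqueness is needed, that is, injectivity of the pairing
  function and uniqueness of remainders, and not Goedel's lemma on the \<open>\<beta>\<close>-function.\<close>

section \<open>Assignments and substitution\<close>

lemma upds_nth:
  "distinct xs \<Longrightarrow> length as = length xs \<Longrightarrow> k < length xs \<Longrightarrow> upds f xs as (xs ! k) = as ! k"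
  by (simp add: upds_def map_of_zip_nth)

lemma upds_notin: "x \<notin> set xs \<Longrightarrow> upds f xs as x = f x"
  unfolding upds_def
  by (auto split: option.split dest!: map_of_SomeD set_zip_leftD)

lemma map_upds:
  "distinct xs \<Longrightarrow> length as = length xs \<Longrightarrow> map (upds f xs as) xs = as"
  by (rule nth_equalityI) (auto simp: upds_nth)

lemma map_upds_disjoint: "set zs \<inter> set xs = {} \<Longrightarrow> map (upds f xs as) zs = map f zs"
  by (intro map_cong refl upds_notin) blast

lemma upds_map: "upds f xs (map g xs) x = (if x \<in> set xs then g x else f x)"
  by (simp add: upds_def map_of_zip_map)

lemma upds_eqI:
  assumes "distinct xs" "length as = length xs" "map g xs = as" "\<And>x. x \<notin> set xs \<Longrightarrow> g x = f x"
  shows "g = upds f xs as"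
  using assms(4) unfolding assms(3)[symmetric] by (auto simp: fun_eq_iff upds_map)

text \<open>Turns the renamed expressions in \<open>alpha\<close> into expressions evaluated on
  vectors of values. The lookup succeeds at every variable of \<open>xs\<close>, so the default
  \<open>d\<close> is arbitrary.\<close>

lemma upds_id_comp:
  assumes "x \<in> set xs" "length us = length xs"
  shows "v (upds id xs us x) = upds d xs (map v us) x"
proof -
  obtain u where "map_of (zip xs us) x = Some u"
    using assms by (metis map_of_zip_is_Some)
  moreover have "map_of (zip xs (map v us)) x = map_option v (map_of (zip xs us) x)"
    by (simp add: zip_map2 map_of_map)
  ultimately show ?thesis by (simp add: upds_def)
qed

lemma upds_Cons: "upds f (x # xs) (a # as) = (upds f xs as)(x := a)"
  by (auto simp: upds_def fun_eq_iff)

lemma upds_fun_upd: "x \<notin> set xs \<Longrightarrow> upds (f(x := a)) xs as = (upds f xs as)(x := a)"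
  by (auto simp: upds_def fun_eq_iff split: option.split dest!: map_of_SomeD set_zip_leftD)

section \<open>Fresh variables, coincidence and substitution\<close>

lemma finite_vars_tm [simp]: "finite (vars_tm t)"
  by (induction t) auto

lemma fresh_var_notin: "finite A \<Longrightarrow> x \<in> A \<Longrightarrow> x < fresh_var A"
  unfolding fresh_var_def by (simp add: less_Suc_eq_le)

lemma fresh_vars:
  "length (fresh_vars n A) = n" "distinct (fresh_vars n A)"
  "finite A \<Longrightarrow> set (fresh_vars n A) \<inter> A = {}"
  using fresh_var_notin unfolding fresh_vars_def by fastforce+

lemma tval_cong: "(\<And>x. x \<in> vars_tm t \<Longrightarrow> v x = v' x) \<Longrightarrow> tval M v t = tval M v' t"
  by (induction t) auto

lemma tval_fun_upd [simp]: "x \<notin> vars_tm t \<Longrightarrow> tval M (v(x := a)) t = tval M v t"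
  by (rule tval_cong) auto

lemma tval_rename: "tval M v (rename_tm f t) = tval M (\<lambda>x. v (f x)) t"
  by (induction t) auto

lemma sat_bexp_cong:
  "(\<And>x. x \<in> vars_bexp B \<Longrightarrow> v x = v' x) \<Longrightarrow> sat M v (fm_of_bexp B) = sat M v' (fm_of_bexp B)"
proof (induction B)
  case (BLess s t)
  then show ?case using tval_cong[of s v v' M] tval_cong[of t v v' M] by auto
qed auto

lemma sat_bexp_rename:
  "sat M v (fm_of_bexp (rename_bexp f B)) = sat M (\<lambda>x. v (f x)) (fm_of_bexp B)"
  by (induction B) (auto simp: tval_rename)

lemma tval_subst: "tval M v (subst_tm x t r) = tval M (v(x := tval M v t)) r"
  by (induction r) auto

text \<open>No quantifier over \<open>y\<close> other than \<open>x\<close> can capture a variable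
  of \<open>t\<close>, because only \<open>x\<close> may occur in \<open>t\<close>. The terms
  substituted in the induction axioms, \<open>TZero\<close> and \<open>x + 1\<close>, are of this
  kind.\<close>

lemma sat_subst:
  "vars_tm t \<subseteq> {x} \<Longrightarrow> sat M v (subst_fm x t \<phi>) = sat M (v(x := tval M v t)) \<phi>"
proof (induction \<phi> arbitrary: v)
  case (Forall y \<phi>)
  have "tval M (v(y := a)) t = tval M v t" if "y \<noteq> x" for a
    using that Forall.prems by (intro tval_fun_upd) auto
  with Forall show ?case
    by (cases "y = x") (simp_all only: subst_fm.simps sat.simps if_True if_False fun_upd_upd
        fun_upd_twist[of y x] simp_thms)
next
  case (Exists y \<phi>)
  have "tval M (v(y := a)) t = tval M v t" if "y \<noteq> x" for a
    using that Exists.prems by (intro tval_fun_upd) auto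
  with Exists show ?case
    by (cases "y = x") (simp_all only: subst_fm.simps sat.simps if_True if_False fun_upd_upd
        fun_upd_twist[of y x] simp_thms)
qed (auto simp: tval_subst)

lemma sat_Exists_list:
  "distinct xs \<Longrightarrow>
    sat M v (Exists_list xs \<phi>) \<longleftrightarrow> (\<exists>as. length as = length xs \<and> sat M (upds v xs as) \<phi>)"
proof (induction xs arbitrary: v)
  case Nil
  then show ?case by (simp add: Exists_list_def upds_def)
next
  case (Cons x xs)
  then have "sat M v (Exists_list (x # xs) \<phi>) \<longleftrightarrow>
      (\<exists>a as. length as = length xs \<and> sat M (upds (v(x := a)) xs as) \<phi>)"
    by (simp add: Exists_list_def)
  \<comment> \<open>Distinctness lets the update at \<open>x\<close> commute with the updates at
    \<open>xs\<close>.\<close>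
  also have "\<dots> \<longleftrightarrow> (\<exists>a as. length as = length xs \<and> sat M (upds v (x # xs) (a # as)) \<phi>)"
    using Cons.prems by (simp add: upds_Cons upds_fun_upd)
  also have "\<dots> \<longleftrightarrow> (\<exists>as. length as = length (x # xs) \<and> sat M (upds v (x # xs) as) \<phi>)"
    by (metis length_Suc_conv length_Cons)
  finally show ?case .
qed

lemma sat_Conj: "sat M v (Conj \<phi>s) \<longleftrightarrow> (\<forall>\<phi>\<in>set \<phi>s. sat M v \<phi>)"
  by (induction \<phi>s) (auto simp: Conj_def)

section \<open>The relations defined by the formulas\<close>

text \<open>The coding functions become relations on elements of the model, parallel to the
  formulas, in which existential quantifiers replace function terms. Here \<open>q\<close> is the
  rounded-down half of \<open>p\<close>, and the disjunction is its parity.\<close>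

definition pair_rel :: "'a lstruct \<Rightarrow> 'a \<Rightarrow> 'a \<Rightarrow> 'a \<Rightarrow> bool" where
  "pair_rel M s t u \<longleftrightarrow> (\<exists>q. let p = tms M (pls M (pls M s t) (uno M)) (pls M s t) in
     (pls M q q = p \<or> pls M (pls M q q) (uno M) = p) \<and> pls M q t = u)"

fun tuple_rel :: "'a lstruct \<Rightarrow> 'a list \<Rightarrow> 'a \<Rightarrow> bool" where
  "tuple_rel M [] c \<longleftrightarrow> True"
| "tuple_rel M [a] c \<longleftrightarrow> a = c"
| "tuple_rel M (a # b # as) c \<longleftrightarrow> (\<exists>s. pair_rel M a s c \<and> tuple_rel M (b # as) s)"

definition beta_rel :: "'a lstruct \<Rightarrow> 'a \<Rightarrow> 'a \<Rightarrow> 'a \<Rightarrow> bool" where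
  "beta_rel M w t c \<longleftrightarrow> (\<exists>l r q. pair_rel M l r w \<and>
     (let m = pls M (tms M r (pls M t (uno M))) (uno M)
      in l = pls M (tms M q m) c \<and> lss M c m))"

definition entry_rel :: "'a lstruct \<Rightarrow> 'a \<Rightarrow> 'a \<Rightarrow> 'a list \<Rightarrow> bool" where
  "entry_rel M w t as \<longleftrightarrow> (\<exists>c. beta_rel M w t c \<and> tuple_rel M as c)"

text \<open>The condition under the bounded quantifier of \<open>seq_fm\<close>, with
  \<open>R\<close> for the relation defined by \<open>\<sigma>\<close>. Fixing the lengths makes the
  decoding of an entry unique.\<close>

definition step_rel ::
  "'a lstruct \<Rightarrow> nat \<Rightarrow> ('a list \<Rightarrow> 'a list \<Rightarrow> bool) \<Rightarrow> 'a \<Rightarrow> 'a \<Rightarrow> bool" where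
  "step_rel M n R w j \<longleftrightarrow> (\<exists>ps qs. length ps = n \<and> length qs = n \<and> entry_rel M w j ps \<and>
     entry_rel M w (pls M j (uno M)) qs \<and> R ps qs)"

definition seq_rel ::
  "'a lstruct \<Rightarrow> nat \<Rightarrow> ('a list \<Rightarrow> 'a list \<Rightarrow> bool) \<Rightarrow> 'a list \<Rightarrow> 'a \<Rightarrow> 'a list \<Rightarrow> bool" where
  "seq_rel M n R as i bs \<longleftrightarrow> (\<exists>w. entry_rel M w (zer M) as \<and>
     (\<forall>j. lss M j i \<longrightarrow> step_rel M n R w j) \<and> entry_rel M w i bs)"

text \<open>The assignment that is constantly \<open>zer M\<close> only fills in the variables outside \<open>xs\<close>, which do
  not matter.\<close>

definition asg :: "'a lstruct \<Rightarrow> nat list \<Rightarrow> 'a list \<Rightarrow> nat \<Rightarrow> 'a" where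
  "asg M xs as = upds (\<lambda>_. zer M) xs as"

text \<open>Where \<open>alpha\<close> renames expressions to the current vector of variables,
  expressions are evaluated here under \<open>asg\<close>. All instances of \<open>alpha\<close> at
  different vectors thus share one relation.\<close>

primrec alpha_rel :: "'a lstruct \<Rightarrow> nat list \<Rightarrow> nat prog \<Rightarrow> 'a list \<Rightarrow> 'a list \<Rightarrow> bool" where
  "alpha_rel M xs (Assign x E) = (\<lambda>as bs.
     bs = map ((asg M xs as)(x := tval M (asg M xs as) E)) xs)"
| "alpha_rel M xs (Comp S1 S2) = (\<lambda>as bs.
     \<exists>cs. length cs = length xs \<and> alpha_rel M xs S1 as cs \<and> alpha_rel M xs S2 cs bs)"
| "alpha_rel M xs (Cond B S1 S2) = (\<lambda>as bs.
     sat M (asg M xs as) (fm_of_bexp B) \<and> alpha_rel M xs S1 as bs \<or>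
     \<not> sat M (asg M xs as) (fm_of_bexp B) \<and> alpha_rel M xs S2 as bs)"
| "alpha_rel M xs (While B S0) = (\<lambda>as bs.
     (\<exists>i. seq_rel M (length xs)
        (\<lambda>ps qs. sat M (asg M xs ps) (fm_of_bexp B) \<and> alpha_rel M xs S0 ps qs) as i bs) \<and>
     \<not> sat M (asg M xs bs) (fm_of_bexp B))"

section \<open>The formulas define these relations\<close>

lemma sat_pair_fm:
  "sat M v (pair_fm s t u) \<longleftrightarrow> pair_rel M (tval M v s) (tval M v t) (tval M v u)"
proof -
  define q where "q = fresh_var (vars_tm s \<union> vars_tm t \<union> vars_tm u)"
  have "q \<notin> vars_tm s" "q \<notin> vars_tm t" "q \<notin> vars_tm u"
    using fresh_var_notin[of "vars_tm s \<union> vars_tm t \<union> vars_tm u"] unfolding q_def by fastforce+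
  then show ?thesis unfolding pair_fm_def pair_rel_def Let_def q_def[symmetric] by simp
qed

lemma sat_tuple_fm: "sat M v (tuple_fm us t) \<longleftrightarrow> tuple_rel M (map v us) (tval M v t)"
proof (induction us t arbitrary: v rule: tuple_fm.induct)
  case (3 u u' us t)
  define s where "s = fresh_var (set (u # u' # us) \<union> vars_tm t)"
  have *: "s \<notin> set (u # u' # us)" "s \<notin> vars_tm t"
    using fresh_var_notin[of "set (u # u' # us) \<union> vars_tm t"] unfolding s_def by fastforce+
  have IH: "sat M v (tuple_fm (u' # us) (TVar s)) \<longleftrightarrow> tuple_rel M (map v (u' # us)) (v s)" for v
    using 3[OF s_def] by simp
  from * have "map (v(s := a)) (u' # us) = map v (u' # us)" for a by auto
  with * show ?case
    by (simp only: tuple_fm.simps Let_def flip: s_def) (simp add: sat_pair_fm IH)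
qed auto

lemma sat_beta_fm:
  "sat M v (beta_fm w t c) \<longleftrightarrow> beta_rel M (v w) (tval M v t) (v c)"
proof -
  define k where "k = fresh_var ({w, c} \<union> vars_tm t)"
  have *: "w < k" "c < k" "\<And>x. x \<in> vars_tm t \<Longrightarrow> x < k"
    unfolding k_def by (rule fresh_var_notin; simp)+
  then have "k \<notin> vars_tm t" "Suc k \<notin> vars_tm t" "Suc (Suc k) \<notin> vars_tm t" by fastforce+
  with * show ?thesis
    unfolding beta_fm_def beta_rel_def Let_def k_def[symmetric] by (simp add: sat_pair_fm)
qed

lemma sat_entry_fm:
  "sat M v (entry_fm w t us) \<longleftrightarrow> entry_rel M (v w) (tval M v t) (map v us)"
proof -
  define c where "c = fresh_var ({w} \<union> vars_tm t \<union> set us)"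
  have "w < c" "\<And>x. x \<in> vars_tm t \<Longrightarrow> x < c" "\<And>x. x \<in> set us \<Longrightarrow> x < c"
    unfolding c_def by (rule fresh_var_notin; simp)+
  then have *: "w \<noteq> c" "c \<notin> vars_tm t" "c \<notin> set us" by fastforce+
  then have "map (v(c := a)) us = map v us" for a by simp
  with * show ?thesis
    unfolding entry_fm_def entry_rel_def Let_def c_def[symmetric]
    by (simp add: sat_beta_fm sat_tuple_fm)
qed

text \<open>Serves both the loop formula, where \<open>R\<close> includes the guard, and
  \<open>phi\<close>, where it does not. The hypothesis covers all vectors of the right length
  because \<open>seq_fm\<close> chooses \<open>ps\<close> and \<open>qs\<close> itself.\<close>

lemma sat_seq_fm:
  assumes \<sigma>: "\<And>v ps qs. length ps = length us \<Longrightarrow> length qs = length us \<Longrightarrow>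
      sat M v (\<sigma> ps qs) \<longleftrightarrow> R (map v ps) (map v qs)"
  shows "sat M v (seq_fm \<sigma> us i ws) \<longleftrightarrow> seq_rel M (length us) R (map v us) (v i) (map v ws)"
proof -
  define n where "n = length us"
  define w where "w = fresh_var (set us \<union> {i} \<union> set ws)"
  define ps where "ps = [w + 2..<w + 2 + n]"
  define qs where "qs = [w + 2 + n..<w + 2 + 2 * n]"
  have w: "i < w" "\<And>x. x \<in> set us \<Longrightarrow> x < w" "\<And>x. x \<in> set ws \<Longrightarrow> x < w"
    unfolding w_def by (rule fresh_var_notin; simp)+
  have len: "length ps = n" "length qs = n" and dist: "distinct ps" "distinct qs"
    and disj: "set ps \<inter> set qs = {}" "w \<notin> set ps" "w \<notin> set qs" "Suc w \<notin> set ps" "Suc w \<notin> set qs"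
    unfolding ps_def qs_def by auto
  have m: "map (v(w := a)) us = map v us" "map (v(w := a)) ws = map v ws" for a
    using w by auto
  have body: "sat M v' (Exists_list ps (Exists_list qs
                   (And (entry_fm w (TVar (Suc w)) ps)
                   (And (entry_fm w (TAdd (TVar (Suc w)) TOne) qs)
                        (\<sigma> ps qs))))) \<longleftrightarrow> step_rel M n R (v' w) (v' (Suc w))" for v'
  proof -
    have eqs: "map (upds (upds v' ps as) qs bs) ps = as" "map (upds (upds v' ps as) qs bs) qs = bs"
      if "length as = n" "length bs = n" for as bs
      using that len dist disj by (simp_all add: map_upds map_upds_disjoint)
    \<comment> \<open>The goal is rewritten as a whole by evaluating its left-hand side; only a
      regrouping of existential quantifiers remains.\<close>
    have "?thesis \<longleftrightarrow> ((\<exists>as. length as = n \<and> (\<exists>bs. length bs = n \<and> entry_rel M (v' w) (v' (Suc w)) as \<and>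
       entry_rel M (v' w) (pls M (v' (Suc w)) (uno M)) bs \<and> R as bs)) \<longleftrightarrow>
       step_rel M n R (v' w) (v' (Suc w)))"
      using len disj eqs
      by (simp add: sat_Exists_list dist sat_entry_fm \<sigma> upds_notin flip: n_def cong: conj_cong)
    then show ?thesis unfolding step_rel_def by blast
  qed
  show ?thesis
    using w(1) body
    unfolding seq_fm_def seq_rel_def Let_def Forall_less_def n_def[symmetric] w_def[symmetric]
      ps_def[symmetric] qs_def[symmetric]
    by (simp add: sat_entry_fm m)
qed

lemma sat_bexp_upds:
  assumes "vars_bexp B \<subseteq> set xs" "length us = length xs"
  shows "sat M v (fm_of_bexp (rename_bexp (upds id xs us) B)) \<longleftrightarrow>
    sat M (asg M xs (map v us)) (fm_of_bexp B)"
  unfolding sat_bexp_rename asg_def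
  by (rule sat_bexp_cong) (use assms in \<open>auto simp: upds_id_comp\<close>)

lemma tval_rename_upds:
  assumes "vars_tm t \<subseteq> set xs" "length us = length xs"
  shows "tval M v (rename_tm (upds id xs us) t) = tval M (asg M xs (map v us)) t"
  unfolding tval_rename asg_def
  by (rule tval_cong) (use assms in \<open>auto simp: upds_id_comp\<close>)

text \<open>The induction on \<open>S\<close> is for arbitrary \<open>v\<close>, \<open>us\<close>
  and \<open>ws\<close>, since composition and loop apply the formulas of subprograms to vectors of
  bound variables.\<close>

lemma sat_alpha:
  assumes "distinct xs" "vars_prog S \<subseteq> set xs" "length us = length xs" "length ws = length xs"
  shows "sat M v (alpha xs S us ws) \<longleftrightarrow> alpha_rel M xs S (map v us) (map v ws)"
  using assms(2-)
proof (induction S arbitrary: v us ws)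
  case (Assign x E)
  then have "sat M v (alpha xs (Assign x E) us ws) \<longleftrightarrow>
    (\<forall>k<length xs. v (ws ! k) = (if xs ! k = x then tval M (asg M xs (map v us)) E else v (us ! k)))"
    by (simp add: sat_Conj tval_rename_upds all_set_conv_all_nth split: prod.split)
  also have "\<dots> \<longleftrightarrow> alpha_rel M xs (Assign x E) (map v us) (map v ws)"
    using Assign assms(1) by (auto simp: list_eq_iff_nth_eq asg_def upds_nth)
  finally show ?case .
next
  case (Comp S1 S2)
  define zs where "zs = fresh_vars (length xs) (set us \<union> set ws)"
  have zs: "length zs = length xs" "distinct zs" "set us \<inter> set zs = {}" "set ws \<inter> set zs = {}"
    using fresh_vars[where n = "length xs" and A = "set us \<union> set ws"] unfolding zs_def by auto
  then have m: "map (upds v zs as) us = map v us" "map (upds v zs as) ws = map v ws" for as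
    by (simp_all only: map_upds_disjoint)
  from zs Comp show ?case
    by (simp add: m sat_Exists_list map_upds flip: zs_def cong: conj_cong)
next
  case (Cond B S1 S2)
  then show ?case by (simp add: sat_bexp_upds Let_def)
next
  case (While B S0)
  define i where "i = fresh_var (set us \<union> set ws)"
  have "\<And>x. x \<in> set us \<union> set ws \<Longrightarrow> x < i"
    unfolding i_def by (rule fresh_var_notin; simp)
  then have m: "map (v(i := a)) us = map v us" "map (v(i := a)) ws = map v ws" for a
    by fastforce+
  have "sat M v (seq_fm
      (\<lambda>ps qs. And (fm_of_bexp (rename_bexp (upds id xs ps) B)) (alpha xs S0 ps qs)) us i ws) \<longleftrightarrow>
     seq_rel M (length xs) (\<lambda>ps qs. sat M (asg M xs ps) (fm_of_bexp B) \<and> alpha_rel M xs S0 ps qs)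
       (map v us) (v i) (map v ws)" for v
    using While by (subst sat_seq_fm[where R =
      "\<lambda>ps qs. sat M (asg M xs ps) (fm_of_bexp B) \<and> alpha_rel M xs S0 ps qs"])
      (auto simp: sat_bexp_upds)
  then show ?case
    using While by (simp add: m Let_def sat_bexp_upds flip: i_def)
qed

section \<open>Arithmetic in models of PA\<close>

locale PA_model =
  fixes M :: "'a lstruct"
  assumes PA: "models_PA M"
begin

abbreviation zero_M ("\<zero>") where "\<zero> \<equiv> zer M"
abbreviation one_M ("\<one>") where "\<one> \<equiv> uno M"
abbreviation plus_M (infixl "\<oplus>" 65) where "a \<oplus> b \<equiv> pls M a b"
abbreviation times_M (infixl "\<otimes>" 70) where "a \<otimes> b \<equiv> tms M a b"
abbreviation less_M (infix "\<prec>" 50) where "a \<prec> b \<equiv> lss M a b"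

lemma sat_PA: "\<phi> \<in> PA \<Longrightarrow> sat M v \<phi>"
  using PA by (simp add: models_PA_def)

lemma suc_neq_zero: "a \<oplus> \<one> \<noteq> \<zero>"
  using sat_PA[of "Neg (Eq (TAdd (TVar 0) TOne) TZero)" "\<lambda>_. a"] by (simp add: PA_def Let_def)

lemma suc_inject: "a \<oplus> \<one> = b \<oplus> \<one> \<Longrightarrow> a = b"
  using sat_PA[of "Imp (Eq (TAdd (TVar 0) TOne) (TAdd (TVar 1) TOne)) (Eq (TVar 0) (TVar 1))"
      "(\<lambda>_. a)(1 := b)"] by (simp add: PA_def Let_def)

lemma add_zero: "a \<oplus> \<zero> = a"
  using sat_PA[of "Eq (TAdd (TVar 0) TZero) (TVar 0)" "\<lambda>_. a"] by (simp add: PA_def Let_def)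

lemma add_suc: "a \<oplus> (b \<oplus> \<one>) = a \<oplus> b \<oplus> \<one>"
  using sat_PA[of "Eq (TAdd (TVar 0) (TAdd (TVar 1) TOne)) (TAdd (TAdd (TVar 0) (TVar 1)) TOne)"
      "(\<lambda>_. a)(1 := b)"] by (simp add: PA_def Let_def)

lemma mult_zero: "a \<otimes> \<zero> = \<zero>"
  using sat_PA[of "Eq (TMul (TVar 0) TZero) TZero" "\<lambda>_. a"] by (simp add: PA_def Let_def)

lemma mult_suc: "a \<otimes> (b \<oplus> \<one>) = a \<otimes> b \<oplus> a"
  using sat_PA[of "Eq (TMul (TVar 0) (TAdd (TVar 1) TOne)) (TAdd (TMul (TVar 0) (TVar 1)) (TVar 0))"
      "(\<lambda>_. a)(1 := b)"] by (simp add: PA_def Let_def)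

lemma less_iff: "a \<prec> b \<longleftrightarrow> (\<exists>c. a \<oplus> (c \<oplus> \<one>) = b)"
  using sat_PA[of "Iff (Lt (TVar 0) (TVar 1))
      (Exists 2 (Eq (TAdd (TVar 0) (TAdd (TVar 2) TOne)) (TVar 1)))" "(\<lambda>_. a)(1 := b)"]
  by (auto simp: PA_def Let_def Iff_def)

lemma sat_induct:
  assumes "sat M (v(x := \<zero>)) \<phi>" "\<And>a. sat M (v(x := a)) \<phi> \<Longrightarrow> sat M (v(x := a \<oplus> \<one>)) \<phi>"
  shows "sat M (v(x := a)) \<phi>"
  using sat_PA[of "induction_axiom x \<phi>" v] assms
  by (auto simp: PA_def Let_def induction_axiom_def sat_subst)

text \<open>Induction in \<open>M\<close> holds for definable predicates only, so each use supplies
  a formula with induction variable 0 and an assignment of the parameters. For instance,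
  \<open>(\<lambda>_. a)(1 := b)\<close> puts \<open>b\<close> at variable 1 and \<open>a\<close> at
  variable 2.\<close>

lemma PA_induct:
  assumes "P \<zero>" "\<And>a. P a \<Longrightarrow> P (a \<oplus> \<one>)" "\<And>a. P a \<longleftrightarrow> sat M (v(0 := a)) \<phi>"
  shows "P a"
  using sat_induct[of v 0 \<phi> a] assms by auto

section \<open>Semiring laws and cancellation\<close>

lemma add_assoc: "a \<oplus> b \<oplus> c = a \<oplus> (b \<oplus> c)"
  by (rule PA_induct[where a = c and v = "(\<lambda>_. a)(1 := b)" and
        \<phi> = "Eq (TAdd (TAdd (TVar 2) (TVar 1)) (TVar 0)) (TAdd (TVar 2) (TAdd (TVar 1) (TVar 0)))"])
    (simp_all add: add_zero add_suc)

lemma zero_add: "\<zero> \<oplus> a = a"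
  by (rule PA_induct[where a = a and \<phi> = "Eq (TAdd TZero (TVar 0)) (TVar 0)"])
    (simp_all add: add_zero add_suc)

text \<open>The instance of commutativity on which its own successor step rests.\<close>

lemma one_add: "\<one> \<oplus> a = a \<oplus> \<one>"
  by (rule PA_induct[where a = a and \<phi> = "Eq (TAdd TOne (TVar 0)) (TAdd (TVar 0) TOne)"])
    (simp_all add: add_zero zero_add add_suc)

lemma add_commute: "a \<oplus> b = b \<oplus> a"
proof (rule PA_induct[where a = b and v = "\<lambda>_. a" and
        \<phi> = "Eq (TAdd (TVar 1) (TVar 0)) (TAdd (TVar 0) (TVar 1))"])
  fix b assume "a \<oplus> b = b \<oplus> a"
  then show "a \<oplus> (b \<oplus> \<one>) = b \<oplus> \<one> \<oplus> a" by (metis add_assoc one_add)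
qed (simp_all add: add_zero zero_add)

lemma add_left_commute: "a \<oplus> (b \<oplus> c) = b \<oplus> (a \<oplus> c)"
  by (metis add_assoc add_commute)

lemmas add_ac = add_assoc add_commute add_left_commute

lemma add_right_cancel: "b \<oplus> a = c \<oplus> a \<longleftrightarrow> b = c"
proof -
  have "b \<oplus> a = c \<oplus> a \<longrightarrow> b = c"
    by (rule PA_induct[where a = a and v = "(\<lambda>_. b)(1 := c)" and \<phi> =
          "Imp (Eq (TAdd (TVar 2) (TVar 0)) (TAdd (TVar 1) (TVar 0))) (Eq (TVar 2) (TVar 1))"])
      (auto simp: add_zero add_suc dest: suc_inject)
  then show ?thesis by auto
qed

lemma add_left_cancel: "a \<oplus> b = a \<oplus> c \<longleftrightarrow> b = c"
  by (metis add_right_cancel add_commute)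

lemma add_self_iff: "a = a \<oplus> b \<longleftrightarrow> b = \<zero>"
  by (metis add_left_cancel add_zero)

lemma distrib_left: "a \<otimes> (b \<oplus> c) = a \<otimes> b \<oplus> a \<otimes> c"
  by (rule PA_induct[where a = c and v = "(\<lambda>_. a)(1 := b)" and
        \<phi> = "Eq (TMul (TVar 2) (TAdd (TVar 1) (TVar 0)))
              (TAdd (TMul (TVar 2) (TVar 1)) (TMul (TVar 2) (TVar 0)))"])
    (simp_all add: add_zero mult_zero mult_suc flip: add_assoc)

lemma distrib_right: "(a \<oplus> b) \<otimes> c = a \<otimes> c \<oplus> b \<otimes> c"
proof (rule PA_induct[where a = c and v = "(\<lambda>_. a)(1 := b)" and
        \<phi> = "Eq (TMul (TAdd (TVar 2) (TVar 1)) (TVar 0))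
              (TAdd (TMul (TVar 2) (TVar 0)) (TMul (TVar 1) (TVar 0)))"])
  fix c assume "(a \<oplus> b) \<otimes> c = a \<otimes> c \<oplus> b \<otimes> c"
  then show "(a \<oplus> b) \<otimes> (c \<oplus> \<one>) = a \<otimes> (c \<oplus> \<one>) \<oplus> b \<otimes> (c \<oplus> \<one>)"
    by (simp add: mult_suc add_ac)
qed (simp_all add: mult_zero add_zero)

lemma mult_one: "a \<otimes> \<one> = a"
  by (metis mult_suc mult_zero zero_add)

lemma one_mult: "\<one> \<otimes> a = a"
  by (rule PA_induct[where a = a and \<phi> = "Eq (TMul TOne (TVar 0)) (TVar 0)"])
    (simp_all add: mult_zero mult_suc)

section \<open>The discrete linear order\<close>

lemma zero_or_suc: "a = \<zero> \<or> (\<exists>b. a = b \<oplus> \<one>)"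
  by (rule PA_induct[where a = a and \<phi> =
        "Or (Eq (TVar 0) TZero) (Exists 1 (Eq (TVar 0) (TAdd (TVar 1) TOne)))"]) auto

lemma add_eq_zero: "a \<oplus> b = \<zero> \<longleftrightarrow> a = \<zero> \<and> b = \<zero>"
proof (cases "b = \<zero>")
  case False
  then obtain c where "b = c \<oplus> \<one>" using zero_or_suc by blast
  then show ?thesis by (simp add: suc_neq_zero flip: add_assoc)
qed (simp add: add_zero)

lemma one_neq_zero: "\<one> \<noteq> \<zero>"
  by (metis suc_neq_zero zero_add)

lemma not_less_zero: "\<not> a \<prec> \<zero>"
  by (simp add: less_iff add_eq_zero one_neq_zero)

lemma less_suc_iff: "a \<prec> b \<oplus> \<one> \<longleftrightarrow> a \<prec> b \<or> a = b"
proof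
  assume "a \<prec> b \<oplus> \<one>"
  then obtain c where "a \<oplus> (c \<oplus> \<one>) = b \<oplus> \<one>" by (auto simp: less_iff)
  then have "a \<oplus> c = b" by (simp add: add_right_cancel flip: add_assoc)
  then show "a \<prec> b \<or> a = b" using zero_or_suc[of c] by (auto simp: less_iff add_zero)
next
  assume "a \<prec> b \<or> a = b"
  then obtain c where "a \<oplus> c = b" unfolding less_iff using add_zero by blast
  then have "a \<oplus> (c \<oplus> \<one>) = b \<oplus> \<one>" by (simp add: add_suc)
  then show "a \<prec> b \<oplus> \<one>" unfolding less_iff by blast
qed

lemma less_suc_self: "a \<prec> a \<oplus> \<one>"
  by (simp add: less_suc_iff)

lemma less_trans: "a \<prec> b \<Longrightarrow> b \<prec> c \<Longrightarrow> a \<prec> c"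
  unfolding less_iff by (metis add_assoc)

text \<open>Discreteness of the order, obtained by adding one on both sides.\<close>

lemma suc_less_or_eq: "a \<prec> b \<Longrightarrow> a \<oplus> \<one> \<prec> b \<or> a \<oplus> \<one> = b"
proof -
  assume "a \<prec> b"
  then obtain c where "a \<oplus> (c \<oplus> \<one>) = b" unfolding less_iff by blast
  then have "a \<oplus> \<one> \<oplus> (c \<oplus> \<one>) = b \<oplus> \<one>" by (simp only: add_ac flip: \<open>a \<oplus> (c \<oplus> \<one>) = b\<close>)
  then have "a \<oplus> \<one> \<prec> b \<oplus> \<one>" unfolding less_iff by blast
  then show ?thesis by (simp add: less_suc_iff)
qed

lemma less_linear: "a \<prec> b \<or> a = b \<or> b \<prec> a"
proof (rule PA_induct[where a = a and v = "\<lambda>_. b" and \<phi> =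
      "Or (Lt (TVar 0) (TVar 1)) (Or (Eq (TVar 0) (TVar 1)) (Lt (TVar 1) (TVar 0)))"])
  \<comment> \<open>The base case takes a second induction, on \<open>b\<close>.\<close>
  show "\<zero> \<prec> b \<or> \<zero> = b \<or> b \<prec> \<zero>"
    by (rule PA_induct[where a = b and \<phi> =
      "Or (Lt TZero (TVar 0)) (Or (Eq TZero (TVar 0)) (Lt (TVar 0) TZero))"])
      (auto simp: less_suc_iff not_less_zero)
qed (auto simp: less_suc_iff dest: suc_less_or_eq)

text \<open>Replaces subtraction: the difference appears explicitly as a successor, so that
  cancellation makes a nonzero element equal to zero.\<close>

lemma eq_or_less_cases:
  obtains "a = b" | z where "b = a \<oplus> (z \<oplus> \<one>)" | z where "a = b \<oplus> (z \<oplus> \<one>)"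
  using less_linear[of a b] unfolding less_iff by metis

text \<open>If one quotient were larger, the remainder belonging to the smaller one would have to
  make up for at least one whole \<open>m\<close>, although it is below \<open>m\<close>.\<close>

lemma remainder_unique:
  assumes "q \<otimes> m \<oplus> c = q' \<otimes> m \<oplus> c'" "c \<prec> m" "c' \<prec> m"
  shows "c = c'"
proof -
  \<comment> \<open>Stated for an arbitrary smaller quotient, so that it serves both orders of
    \<open>q\<close> and \<open>q'\<close>.\<close>
  have *: False if eq: "q \<otimes> m \<oplus> c = (q \<oplus> (z \<oplus> \<one>)) \<otimes> m \<oplus> c'" and "c \<prec> m" for q c z c'
  proof -
    from \<open>c \<prec> m\<close> obtain y where y: "m = c \<oplus> (y \<oplus> \<one>)" by (auto simp: less_iff)
    from eq have "c = z \<otimes> m \<oplus> m \<oplus> c'"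
      by (simp add: distrib_right one_mult add_assoc add_left_cancel)
    also have "\<dots> = z \<otimes> m \<oplus> (c \<oplus> (y \<oplus> \<one>)) \<oplus> c'"
      by (simp flip: y)
    also have "\<dots> = c \<oplus> (y \<oplus> \<one> \<oplus> z \<otimes> m \<oplus> c')"
      by (simp only: add_ac)
    finally have "c = c \<oplus> (y \<oplus> \<one> \<oplus> z \<otimes> m \<oplus> c')" .
    then show False by (simp add: add_self_iff add_eq_zero one_neq_zero)
  qed
  show ?thesis
  proof (cases q q' rule: eq_or_less_cases)
    case 1
    with assms(1) show ?thesis by (simp add: add_left_cancel)
  next
    case 2
    with assms(1,2) show ?thesis using * by blast
  next
    case 3
    with assms(1,3) show ?thesis using *[OF sym] by blast
  qed
qed

section \<open>Parity and injectivity of the pairing function\<close>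

lemma double_neq_suc_double: "a \<oplus> a \<noteq> b \<oplus> b \<oplus> \<one>"
proof
  assume eq: "a \<oplus> a = b \<oplus> b \<oplus> \<one>"
  show False
  \<comment> \<open>For equal elements \<open>\<one> = \<zero>\<close> would follow; otherwise one
    side exceeds the other by a successor.\<close>
  proof (cases a b rule: eq_or_less_cases)
    case 1
    with eq show ?thesis by (simp add: add_self_iff one_neq_zero)
  next
    case (2 z)
    have "b \<oplus> b \<oplus> \<one> = a \<oplus> a \<oplus> (z \<oplus> z \<oplus> \<one> \<oplus> \<one> \<oplus> \<one>)"
      unfolding 2 by (simp only: add_ac)
    from trans[OF eq this] show ?thesis by (simp only: add_self_iff suc_neq_zero)
  next
    case (3 z)
    have "a \<oplus> a = b \<oplus> b \<oplus> \<one> \<oplus> (z \<oplus> z \<oplus> \<one>)"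
      unfolding 3 by (simp only: add_ac)
    from trans[OF eq[symmetric] this] show ?thesis by (simp only: add_self_iff suc_neq_zero)
  qed
qed

lemma double_less: "a \<oplus> a \<noteq> a \<oplus> (z \<oplus> \<one>) \<oplus> (a \<oplus> (z \<oplus> \<one>))"
proof
  assume "a \<oplus> a = a \<oplus> (z \<oplus> \<one>) \<oplus> (a \<oplus> (z \<oplus> \<one>))"
  also have "\<dots> = a \<oplus> a \<oplus> (z \<oplus> z \<oplus> \<one> \<oplus> \<one>)"
    by (simp only: add_ac)
  finally show False by (simp only: add_self_iff suc_neq_zero)
qed

lemma double_inject: "a \<oplus> a = b \<oplus> b \<Longrightarrow> a = b"
  by (cases a b rule: eq_or_less_cases) (metis double_less)+

text \<open>If \<open>s + t < s' + t'\<close>, then the triangular number below the second code exceeds the one below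
  the first by more than \<open>s + t\<close>.\<close>

lemma pair_rel_sum_not_less:
  assumes "pair_rel M s t u" "pair_rel M s' t' u"
  shows "\<not> s \<oplus> t \<prec> s' \<oplus> t'"
proof
  define d where "d = s \<oplus> t"
  assume "s \<oplus> t \<prec> s' \<oplus> t'"
  then obtain z where z: "s' \<oplus> t' = d \<oplus> (z \<oplus> \<one>)"
    unfolding less_iff d_def by metis
  define p where "p = (d \<oplus> \<one>) \<otimes> d"
  \<comment> \<open>For D = d + z + 1, the product (D + 1)D equals p + 2d + 2 + y with surplus y =
    2dz + z^2 + 3z.\<close>
  have "\<exists>y. (d \<oplus> (z \<oplus> \<one>) \<oplus> \<one>) \<otimes> (d \<oplus> (z \<oplus> \<one>)) = p \<oplus> d \<oplus> d \<oplus> \<one> \<oplus> \<one> \<oplus> y"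
    unfolding p_def
    by (rule exI[where x = "d \<otimes> z \<oplus> z \<otimes> d \<oplus> z \<otimes> z \<oplus> z \<oplus> z \<oplus> z"])
      (simp add: distrib_left distrib_right one_mult mult_one add_ac)
  then obtain y where y: "(s' \<oplus> t' \<oplus> \<one>) \<otimes> (s' \<oplus> t') = p \<oplus> d \<oplus> d \<oplus> \<one> \<oplus> \<one> \<oplus> y"
    unfolding z by blast
  \<comment> \<open>Both parities of \<open>p\<close> are treated at once: \<open>e\<close> is zero
    or one.\<close>
  from assms(1) obtain q e where q: "p = q \<oplus> q \<oplus> e" "q \<oplus> t = u"
    unfolding pair_rel_def Let_def d_def[symmetric] p_def[symmetric] by (metis add_zero)
  from assms(2) obtain q' where q': "q' \<oplus> q' = p \<oplus> d \<oplus> d \<oplus> \<one> \<oplus> \<one> \<oplus> y \<or>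
      q' \<oplus> q' \<oplus> \<one> = p \<oplus> d \<oplus> d \<oplus> \<one> \<oplus> \<one> \<oplus> y" "q' \<oplus> t' = u"
    unfolding pair_rel_def Let_def y by blast
  \<comment> \<open>Doubling q + d = q' + x gives p + 2d + 2 + y = 2q' + 2x + e + 2 + y, which is
    larger than both 2q' and 2q' + 1.\<close>
  have le: False if "q \<oplus> d = q' \<oplus> x" for x
  proof -
    have "p \<oplus> d \<oplus> d \<oplus> \<one> \<oplus> \<one> \<oplus> y = (q \<oplus> d) \<oplus> (q \<oplus> d) \<oplus> (e \<oplus> \<one> \<oplus> \<one> \<oplus> y)"
      unfolding q by (simp add: add_ac)
    also have "\<dots> = q' \<oplus> q' \<oplus> (\<one> \<oplus> (x \<oplus> x \<oplus> e \<oplus> \<one> \<oplus> y))"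
      unfolding that by (simp add: add_ac)
    finally have "q' \<oplus> q' = q' \<oplus> q' \<oplus> (\<one> \<oplus> (x \<oplus> x \<oplus> e \<oplus> \<one> \<oplus> y)) \<or>
        q' \<oplus> q' \<oplus> \<one> = q' \<oplus> q' \<oplus> \<one> \<oplus> (x \<oplus> x \<oplus> e \<oplus> \<one> \<oplus> y)"
      using q'(1) by (simp add: add_assoc)
    then show False by (simp only: add_self_iff add_eq_zero one_neq_zero simp_thms)
  qed
  show False
  proof (cases "q \<oplus> d" q' rule: eq_or_less_cases)
    case 1
    then show ?thesis using le[of \<zero>] by (simp add: add_zero)
  next
    case (2 x)
    \<comment> \<open>Now q' > q + d, and d = s + t is at least t, so the second code exceeds the
      first.\<close>
    have "q \<oplus> t = q' \<oplus> t'" using q(2) q'(2) by simp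
    also have "\<dots> = q \<oplus> t \<oplus> (s \<oplus> x \<oplus> \<one> \<oplus> t')"
      unfolding 2 d_def by (simp only: add_ac)
    finally show ?thesis by (simp only: add_self_iff add_eq_zero one_neq_zero simp_thms)
  next
    case (3 x)
    then show ?thesis by (rule le)
  qed
qed

text \<open>Equal codes have equal sums by the previous lemma, hence the same product
  \<open>p\<close>. Parity determines the half of \<open>p\<close>; then cancellation gives the
  second component from \<open>u\<close> and the first from the sum.\<close>

lemma pair_rel_inject:
  assumes "pair_rel M s t u" "pair_rel M s' t' u"
  shows "s = s' \<and> t = t'"
proof -
  have d: "s \<oplus> t = s' \<oplus> t'"
    using pair_rel_sum_not_less[OF assms] pair_rel_sum_not_less[OF assms(2,1)]
      less_linear[of "s \<oplus> t" "s' \<oplus> t'"] by simp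
  define p where "p = (s' \<oplus> t' \<oplus> \<one>) \<otimes> (s' \<oplus> t')"
  from assms(1) obtain q where q: "q \<oplus> q = p \<or> q \<oplus> q \<oplus> \<one> = p" "q \<oplus> t = u"
    unfolding pair_rel_def Let_def d p_def[symmetric] by blast
  from assms(2) obtain q' where q': "q' \<oplus> q' = p \<or> q' \<oplus> q' \<oplus> \<one> = p" "q' \<oplus> t' = u"
    unfolding pair_rel_def Let_def p_def[symmetric] by blast
  from q(1) q'(1) have "q \<oplus> q = q' \<oplus> q'"
    by (metis double_neq_suc_double suc_inject)
  then have "q = q'" by (rule double_inject)
  with q(2) q'(2) have "q' \<oplus> t = q' \<oplus> t'" by metis
  then have "t = t'" by (simp only: add_left_cancel)
  with d show ?thesis by (simp add: add_right_cancel)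
qed

end

section \<open>Uniqueness of coded sequences\<close>

text \<open>Restricted to vectors of one length, because one element can code tuples of several
  lengths.\<close>

definition functional_on :: "nat \<Rightarrow> ('a list \<Rightarrow> 'a list \<Rightarrow> bool) \<Rightarrow> bool" where
  "functional_on n R \<longleftrightarrow> (\<forall>as bs cs. length as = n \<longrightarrow> length bs = n \<longrightarrow> length cs = n \<longrightarrow>
     R as bs \<longrightarrow> R as cs \<longrightarrow> bs = cs)"

lemma functional_onD:
  "functional_on n R \<Longrightarrow> length as = n \<Longrightarrow> length bs = n \<Longrightarrow> length cs = n \<Longrightarrow>
    R as bs \<Longrightarrow> R as cs \<Longrightarrow> bs = cs"
  unfolding functional_on_def by blast

lemma functional_on_guard: "functional_on n R \<Longrightarrow> functional_on n (\<lambda>as bs. B as \<and> R as bs)"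
  unfolding functional_on_def by blast

context PA_model
begin

lemma tuple_rel_inject:
  "length as = length bs \<Longrightarrow> tuple_rel M as c \<Longrightarrow> tuple_rel M bs c \<Longrightarrow> as = bs"
proof (induction as arbitrary: bs c rule: induct_list012)
  case (3 a b as)
  then obtain a' b' bs' where "bs = a' # b' # bs'" by (metis length_Suc_conv length_Cons)
  moreover from this 3(4,5) obtain s s' where
    "pair_rel M a s c" "pair_rel M a' s' c" "tuple_rel M (b # as) s" "tuple_rel M (b' # bs') s'"
    by auto
  moreover from this have "a = a'" "s = s'" using pair_rel_inject by blast+
  ultimately show ?case using 3(2)[of "b' # bs'" s] 3(3) by simp
next
  case (2 a)
  then show ?case by (cases bs) auto
qed simp

lemma beta_rel_unique: "beta_rel M w t c \<Longrightarrow> beta_rel M w t c' \<Longrightarrow> c = c'"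
  unfolding beta_rel_def Let_def by (metis pair_rel_inject remainder_unique)

lemma entry_rel_unique:
  "entry_rel M w t as \<Longrightarrow> entry_rel M w t bs \<Longrightarrow> length as = length bs \<Longrightarrow> as = bs"
  unfolding entry_rel_def by (metis beta_rel_unique tuple_rel_inject)

text \<open>Uniqueness of entries identifies the existentially quantified predecessor in
  \<open>step_rel\<close> with the given \<open>as\<close>.\<close>

lemma step_relE:
  assumes "step_rel M n R w j" "entry_rel M w j as" "length as = n"
  obtains bs where "length bs = n" "entry_rel M w (j \<oplus> \<one>) bs" "R as bs"
  using assms unfolding step_rel_def by (metis entry_rel_unique)

text \<open>The induction in the model is on a formula saying that the entries at \<open>j\<close> of both codes
  coincide.\<close>

lemma steps_agree:
  assumes fn: "functional_on n R"
    and start: "length as = n" "entry_rel M w \<zero> as" "entry_rel M w' \<zero> as"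
    and steps: "\<And>j. j \<prec> i \<Longrightarrow> step_rel M n R w j" "\<And>j. j \<prec> i \<Longrightarrow> step_rel M n R w' j"
    and le: "j \<prec> i \<or> j = i"
  shows "\<exists>bs. length bs = n \<and> entry_rel M w j bs \<and> entry_rel M w' j bs"
proof -
  \<comment> \<open>Variables 0 to 3 hold \<open>j\<close>, \<open>i\<close>, \<open>w\<close> and
    \<open>w'\<close>, so the vector for the common entry starts at 4. The induction formula
    mentions entries only; \<open>R\<close> enters through the successor step, outside the
    formula.\<close>
  define us where "us = [4..<4 + n]"
  define \<phi> where "\<phi> = Imp (Or (Lt (TVar 0) (TVar 1)) (Eq (TVar 0) (TVar 1)))
    (Exists_list us (And (entry_fm 2 (TVar 0) us) (entry_fm 3 (TVar 0) us)))"
  define v where "v = (\<lambda>_ :: nat. \<zero>)(1 := i, 2 := w, 3 := w')"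
  have us: "length us = n" "distinct us" "0 \<notin> set us" "2 \<notin> set us" "3 \<notin> set us"
    by (auto simp: us_def)
  have sat: "(j \<prec> i \<or> j = i \<longrightarrow> (\<exists>bs. length bs = n \<and> entry_rel M w j bs \<and> entry_rel M w' j bs))
      \<longleftrightarrow> sat M (v(0 := j)) \<phi>" for j
    using us by (simp add: \<phi>_def v_def sat_Exists_list sat_entry_fm upds_notin map_upds
        cong: conj_cong)
  have "j \<prec> i \<or> j = i \<longrightarrow> (\<exists>bs. length bs = n \<and> entry_rel M w j bs \<and> entry_rel M w' j bs)"
  proof (rule PA_induct[where a = j and v = v and \<phi> = \<phi>, OF _ _ sat], goal_cases)
    case 1
    with start show ?case by blast
  next
    case (2 j)
    show ?case
    proof
      assume "j \<oplus> \<one> \<prec> i \<or> j \<oplus> \<one> = i"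
      then have "j \<prec> i" using less_suc_self less_trans by blast
      with 2 obtain bs where bs: "length bs = n" "entry_rel M w j bs" "entry_rel M w' j bs"
        by blast
      obtain cs where cs: "length cs = n" "entry_rel M w (j \<oplus> \<one>) cs" "R bs cs"
        using step_relE[OF steps(1)[OF \<open>j \<prec> i\<close>] bs(2,1)] .
      obtain ds where ds: "length ds = n" "entry_rel M w' (j \<oplus> \<one>) ds" "R bs ds"
        using step_relE[OF steps(2)[OF \<open>j \<prec> i\<close>] bs(3,1)] .
      have "cs = ds" using functional_onD[OF fn bs(1) cs(1) ds(1) cs(3) ds(3)] .
      with cs ds show "\<exists>bs. length bs = n \<and> entry_rel M w (j \<oplus> \<one>) bs \<and> entry_rel M w' (j \<oplus> \<one>) bs"
        by blast
    qed
  qed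
  with le show ?thesis by blast
qed

text \<open>The two codes themselves may differ, but their entries at the last index agree.\<close>

lemma seq_rel_unique:
  assumes fn: "functional_on n R"
    and "seq_rel M n R as i bs" "seq_rel M n R as i cs"
    and len: "length as = n" "length bs = n" "length cs = n"
  shows "bs = cs"
proof -
  from assms(2) obtain w where w: "entry_rel M w \<zero> as" "\<And>j. j \<prec> i \<Longrightarrow> step_rel M n R w j"
    "entry_rel M w i bs" unfolding seq_rel_def by blast
  from assms(3) obtain w' where w': "entry_rel M w' \<zero> as" "\<And>j. j \<prec> i \<Longrightarrow> step_rel M n R w' j"
    "entry_rel M w' i cs" unfolding seq_rel_def by blast
  obtain ds where "length ds = n" "entry_rel M w i ds" "entry_rel M w' i ds"
    using steps_agree[OF fn len(1) w(1) w'(1) w(2) w'(2), of i i] by blast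
  with w(3) w'(3) len show ?thesis by (metis entry_rel_unique)
qed

text \<open>A longer run would have the same entry at \<open>i\<close> and would demand the guard
  there, where it fails. This determines the number of iterations of a loop.\<close>

lemma seq_rel_not_shorter:
  assumes fn: "functional_on n R"
    and "seq_rel M n (\<lambda>ps qs. B ps \<and> R ps qs) as i bs" "\<not> B bs"
      "seq_rel M n (\<lambda>ps qs. B ps \<and> R ps qs) as i' cs"
    and len: "length as = n" "length bs = n"
  shows "\<not> i \<prec> i'"
proof
  let ?R = "\<lambda>ps qs. B ps \<and> R ps qs"
  assume "i \<prec> i'"
  from assms(2) obtain w where w: "entry_rel M w \<zero> as" "\<And>j. j \<prec> i \<Longrightarrow> step_rel M n ?R w j"
    "entry_rel M w i bs" unfolding seq_rel_def by blast
  from assms(4) obtain w' where w': "entry_rel M w' \<zero> as"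
    "\<And>j. j \<prec> i' \<Longrightarrow> step_rel M n ?R w' j" unfolding seq_rel_def by blast
  obtain ds where ds: "length ds = n" "entry_rel M w i ds" "entry_rel M w' i ds"
    using steps_agree[OF functional_on_guard[OF fn] len(1) w(1) w'(1), of i B i]
      w(2) w'(2)[OF less_trans[OF _ \<open>i \<prec> i'\<close>]] by blast
  with w(3) len have "ds = bs" by (metis entry_rel_unique)
  moreover have "B ds" using step_relE[OF w'(2)[OF \<open>i \<prec> i'\<close>] ds(3,1)] by blast
  ultimately show False using \<open>\<not> B bs\<close> by simp
qed

lemma functional_on_alpha_rel: "functional_on (length xs) (alpha_rel M xs S)"
proof (induction S)
  case (Comp S1 S2)
  then show ?case unfolding functional_on_def alpha_rel.simps by metis
next
  case (While B S0)
  let ?n = "length xs" and ?B = "\<lambda>ps. sat M (asg M xs ps) (fm_of_bexp B)"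
  let ?R = "\<lambda>ps qs. ?B ps \<and> alpha_rel M xs S0 ps qs"
  have "bs = cs" if len: "length as = ?n" "length bs = ?n" "length cs = ?n"
    and i: "seq_rel M ?n ?R as i bs" "\<not> ?B bs" and i': "seq_rel M ?n ?R as i' cs" "\<not> ?B cs"
  for as bs cs i i'
  proof -
    \<comment> \<open>Neither run can stop before the other, so both have the same number of
      iterations.\<close>
    have "\<not> i \<prec> i'" using seq_rel_not_shorter[OF While i i'(1) len(1,2)] .
    moreover have "\<not> i' \<prec> i" using seq_rel_not_shorter[OF While i' i(1) len(1,3)] .
    ultimately have "i = i'" using less_linear by blast
    with i(1) i'(1) show ?thesis
      using seq_rel_unique[OF functional_on_guard[OF While, of ?B] _ _ len] by blast
  qed
  then show ?case unfolding functional_on_def alpha_rel.simps by blast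
qed (auto simp: functional_on_def)

section \<open>The X-semantics\<close>

text \<open>Frees the loop clause of \<open>xsem\<close> from its particular variables
  \<open>y\<close> and \<open>zs\<close>; the resulting sequence relation carries no guard.\<close>

lemma holds_phi:
  assumes "distinct xs" "vars_prog S \<subseteq> set xs" "length as = length xs" "length bs = length xs"
  defines "y \<equiv> fresh_var (set xs)"
  defines "zs \<equiv> fresh_vars (length xs) (insert y (set xs))"
  shows "holds M (phi xs S xs y zs) (xs @ [y] @ zs) (as @ [j] @ bs) \<longleftrightarrow>
    seq_rel M (length xs) (alpha_rel M xs S) as j bs"
proof -
  have y: "y \<notin> set xs" using fresh_var_notin[of "set xs"] unfolding y_def by fastforce
  have zs: "length zs = length xs" "distinct zs" "set zs \<inter> insert y (set xs) = {}"
    unfolding zs_def by (simp_all add: fresh_vars)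
  let ?xs = "xs @ [y] @ zs"
  have "map (upds v ?xs (as @ [j] @ bs)) ?xs = as @ [j] @ bs" for v
    using assms y zs by (intro map_upds) auto
  then have "map (upds v ?xs (as @ [j] @ bs)) xs = as" "upds v ?xs (as @ [j] @ bs) y = j"
    "map (upds v ?xs (as @ [j] @ bs)) zs = bs" for v
    using assms zs by (simp_all del: append.simps add: append_eq_append_conv)
  then show ?thesis
    unfolding holds_def phi_def using assms zs
    by (subst sat_seq_fm[where R = "alpha_rel M xs S"]) (auto simp: sat_alpha)
qed

lemma sat_bexp_asg:
  "vars_bexp B \<subseteq> set xs \<Longrightarrow> sat M v (fm_of_bexp B) \<longleftrightarrow> sat M (asg M xs (map v xs)) (fm_of_bexp B)"
  unfolding asg_def by (rule sat_bexp_cong) (auto simp: upds_map)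

lemma upds_upds: "distinct xs \<Longrightarrow> length as = length xs \<Longrightarrow> length bs = length xs \<Longrightarrow>
    upds (upds v xs as) xs bs = upds v xs bs"
  by (rule upds_eqI) (auto simp: map_upds upds_notin)

lemma xsem_While:
  assumes "distinct xs" "vars_prog S \<subseteq> set xs"
  shows "(v, v') \<in> xsem M xs (While B S) \<longleftrightarrow> (\<exists>i X.
    (\<forall>j. j \<prec> i \<or> j = i \<longrightarrow> length (X j) = length xs \<and>
       seq_rel M (length xs) (alpha_rel M xs S) (map v xs) j (X j)) \<and>
    map v xs = X \<zero> \<and>
    (\<forall>j. j \<prec> i \<longrightarrow> sat M (upds v xs (X j)) (fm_of_bexp B) \<and>
       (upds v xs (X j), upds v xs (X (j \<oplus> \<one>))) \<in> xsem M xs S) \<and>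
    v' = upds v xs (X i) \<and> \<not> sat M v' (fm_of_bexp B))"
  by (simp only: xsem.simps Let_def mem_Collect_eq prod.case holds_phi[OF assms] length_map
      cong: conj_cong)

lemma xsem_While_imp:
  assumes xs: "distinct xs" "vars_prog (While B S) \<subseteq> set xs"
    and IH: "\<And>v v'. (v, v') \<in> xsem M xs S \<longleftrightarrow>
      (\<exists>bs. length bs = length xs \<and> alpha_rel M xs S (map v xs) bs \<and> v' = upds v xs bs)"
    and sem: "(v, v') \<in> xsem M xs (While B S)"
  shows "\<exists>bs. length bs = length xs \<and> alpha_rel M xs (While B S) (map v xs) bs \<and> v' = upds v xs bs"
proof -
  let ?n = "length xs" and ?R = "alpha_rel M xs S"
  let ?B = "\<lambda>ps. sat M (asg M xs ps) (fm_of_bexp B)"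
  have S: "vars_prog S \<subseteq> set xs" using xs(2) by simp
  have B: "sat M (upds u xs as) (fm_of_bexp B) \<longleftrightarrow> ?B as" if "length as = ?n" for u as
    using sat_bexp_asg[of B xs "upds u xs as"] xs that by (simp add: map_upds)
  from sem obtain i X where len: "\<And>j. j \<prec> i \<or> j = i \<Longrightarrow> length (X j) = ?n"
    and phi: "\<And>j. j \<prec> i \<or> j = i \<Longrightarrow> seq_rel M ?n ?R (map v xs) j (X j)"
    and guard: "\<And>j. j \<prec> i \<Longrightarrow> sat M (upds v xs (X j)) (fm_of_bexp B)"
    and v': "v' = upds v xs (X i)" "\<not> sat M v' (fm_of_bexp B)"
    unfolding xsem_While[OF xs(1) S] by blast
  \<comment> \<open>The steps come from \<open>phi\<close> at the last index; the guards are added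
    from the family \<open>X\<close>.\<close>
  obtain w where w: "entry_rel M w \<zero> (map v xs)" "\<And>j. j \<prec> i \<Longrightarrow> step_rel M ?n ?R w j"
    "entry_rel M w i (X i)"
    using phi[of i] unfolding seq_rel_def by blast
  have "step_rel M ?n (\<lambda>ps qs. ?B ps \<and> ?R ps qs) w j" if "j \<prec> i" for j
  proof -
    from w(2)[OF that] obtain ps qs where pq: "length ps = ?n" "length qs = ?n"
      "entry_rel M w j ps" "entry_rel M w (j \<oplus> \<one>) qs" "?R ps qs"
      unfolding step_rel_def by blast
    \<comment> \<open>The part of \<open>w\<close> up to \<open>j\<close> shows that
      \<open>ps\<close> is reached after \<open>j\<close> iterations, as is \<open>X j\<close>;
      uniqueness then equates them.\<close>
    have "seq_rel M ?n ?R (map v xs) j ps"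
      unfolding seq_rel_def using w pq(3) less_trans[OF _ that] by blast
    from seq_rel_unique[OF functional_on_alpha_rel this phi _ pq(1) len] that
    have "ps = X j" by simp
    with guard[OF that] pq(1) xs(1) have "?B ps" by (simp add: B)
    with pq show ?thesis unfolding step_rel_def by blast
  qed
  with w have "seq_rel M ?n (\<lambda>ps qs. ?B ps \<and> ?R ps qs) (map v xs) i (X i)"
    unfolding seq_rel_def by blast
  moreover from v' len[of i] xs(1) have "\<not> ?B (X i)" by (simp add: B)
  ultimately show ?thesis using v'(1) len[of i] by auto
qed

lemma xsem_While_if:
  assumes xs: "distinct xs" "vars_prog (While B S) \<subseteq> set xs"
    and IH: "\<And>v v'. (v, v') \<in> xsem M xs S \<longleftrightarrow>
      (\<exists>bs. length bs = length xs \<and> alpha_rel M xs S (map v xs) bs \<and> v' = upds v xs bs)"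
    and bs: "length bs = length xs" "alpha_rel M xs (While B S) (map v xs) bs"
  shows "(v, upds v xs bs) \<in> xsem M xs (While B S)"
proof -
  let ?n = "length xs" and ?R = "alpha_rel M xs S"
  let ?B = "\<lambda>ps. sat M (asg M xs ps) (fm_of_bexp B)"
  have S: "vars_prog S \<subseteq> set xs" using xs(2) by simp
  have B: "sat M (upds u xs as) (fm_of_bexp B) \<longleftrightarrow> ?B as" if "length as = ?n" for u as
    using sat_bexp_asg[of B xs "upds u xs as"] xs that by (simp add: map_upds)
  from bs(2) obtain i w where w: "entry_rel M w \<zero> (map v xs)"
    "\<And>j. j \<prec> i \<Longrightarrow> step_rel M ?n (\<lambda>ps qs. ?B ps \<and> ?R ps qs) w j" "entry_rel M w i bs"
    and end_guard: "\<not> ?B bs"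
    unfolding alpha_rel.simps seq_rel_def by blast
  \<comment> \<open>An entry below \<open>i\<close> is provided by its step, the one at
    \<open>i\<close> is \<open>bs\<close>. With the implication inside the quantifier,
    \<open>choice\<close> yields a family on all of \<open>M\<close>.\<close>
  have "\<exists>as. j \<prec> i \<or> j = i \<longrightarrow> length as = ?n \<and> entry_rel M w j as" for j
    using w(2)[of j] w(3) bs(1) unfolding step_rel_def by blast
  then have "\<exists>X. \<forall>j. j \<prec> i \<or> j = i \<longrightarrow> length (X j) = ?n \<and> entry_rel M w j (X j)"
    by (intro choice allI)
  then obtain X where X: "\<And>j. j \<prec> i \<or> j = i \<Longrightarrow> length (X j) = ?n"
    "\<And>j. j \<prec> i \<or> j = i \<Longrightarrow> entry_rel M w j (X j)" by blast
  have Xi: "X i = bs" using entry_rel_unique[OF X(2) w(3)] X(1) bs(1) by simp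
  have step: "?B (X j) \<and> ?R (X j) (X (j \<oplus> \<one>))" if ji: "j \<prec> i" for j
  proof -
    have j: "j \<prec> i \<or> j = i" using ji by blast
    obtain cs where cs: "length cs = ?n" "entry_rel M w (j \<oplus> \<one>) cs" "?B (X j)" "?R (X j) cs"
      using step_relE[OF w(2)[OF ji] X(2,1)[OF j]] by blast
    \<comment> \<open>By discreteness \<open>j + 1\<close> is at most \<open>i\<close>, so
      \<open>X\<close> gives the entry of \<open>w\<close> there too.\<close>
    with entry_rel_unique[OF cs(2) X(2)] X(1) suc_less_or_eq[OF ji] show ?thesis by simp
  qed
  have "zer M \<prec> i \<or> zer M = i" using less_linear[of \<zero> i] not_less_zero by blast
  then have X0: "map v xs = X \<zero>"
    using entry_rel_unique[OF w(1) X(2)] X(1) by simp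
  have seq: "seq_rel M ?n ?R (map v xs) j (X j)" if "j \<prec> i \<or> j = i" for j
  proof -
    \<comment> \<open>The same code \<open>w\<close>, cut off at \<open>j\<close> and with the guard
      dropped, witnesses \<open>phi\<close> for every \<open>j\<close>.\<close>
    have "step_rel M ?n ?R w k" if "k \<prec> j" for k
      using w(2)[of k] less_trans[of k j i] that \<open>j \<prec> i \<or> j = i\<close> unfolding step_rel_def by blast
    then show ?thesis unfolding seq_rel_def using w(1) X(2)[OF that] by blast
  qed
  have "sat M (upds v xs (X j)) (fm_of_bexp B) \<and>
      (upds v xs (X j), upds v xs (X (j \<oplus> \<one>))) \<in> xsem M xs S" if "j \<prec> i" for j
  proof -
    have len: "length (X j) = ?n" "length (X (j \<oplus> \<one>)) = ?n"
      using X(1) suc_less_or_eq[OF that] that by blast+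
    \<comment> \<open>\<open>IH\<close> requires the target assignment in the form of an update of
      the source.\<close>
    then have "map (upds v xs (X j)) xs = X j"
      "upds v xs (X (j \<oplus> \<one>)) = upds (upds v xs (X j)) xs (X (j \<oplus> \<one>))"
      using xs(1) by (simp_all add: map_upds upds_upds)
    with step[OF that] len(2) show ?thesis unfolding IH B[OF len(1)] by metis
  qed
  moreover have "\<not> sat M (upds v xs bs) (fm_of_bexp B)"
    using end_guard bs(1) xs(1) by (simp add: B)
  ultimately show ?thesis
    unfolding xsem_While[OF xs(1) S] using X(1) Xi X0 seq by blast
qed

text \<open>The final assignment is described completely, including that variables outside
  \<open>xs\<close> keep their values; this makes the description closed under composition.\<close>

lemma xsem_iff_alpha_rel:
  assumes "distinct xs" "vars_prog S \<subseteq> set xs"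
  shows "(v, v') \<in> xsem M xs S \<longleftrightarrow>
    (\<exists>bs. length bs = length xs \<and> alpha_rel M xs S (map v xs) bs \<and> v' = upds v xs bs)"
  using assms(2)
proof (induction S arbitrary: v v')
  case (Assign x E)
  have v: "asg M xs (map v xs) z = v z" if "z \<in> set xs" for z
    using that by (simp add: asg_def upds_map)
  then have E: "tval M (asg M xs (map v xs)) E = tval M v E"
    using Assign by (intro tval_cong) auto
  have m: "map ((asg M xs (map v xs))(x := tval M (asg M xs (map v xs)) E)) xs =
      map (v(x := tval M v E)) xs" unfolding E by (intro map_cong) (simp_all add: v)
  have "upds v xs (map (v(x := tval M v E)) xs) = v(x := tval M v E)"
    using Assign by (auto simp: fun_eq_iff upds_map)
  then show ?case by (simp add: m)
next
  case (Comp S1 S2)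
  then have IH: "(v, v') \<in> xsem M xs S1 \<longleftrightarrow>
      (\<exists>bs. length bs = length xs \<and> alpha_rel M xs S1 (map v xs) bs \<and> v' = upds v xs bs)"
    "(v, v') \<in> xsem M xs S2 \<longleftrightarrow>
      (\<exists>bs. length bs = length xs \<and> alpha_rel M xs S2 (map v xs) bs \<and> v' = upds v xs bs)" for v v'
    by simp_all
  have "(v, v') \<in> xsem M xs (Comp S1 S2) \<longleftrightarrow>
      (\<exists>cs bs. length cs = length xs \<and> alpha_rel M xs S1 (map v xs) cs \<and> length bs = length xs \<and>
        alpha_rel M xs S2 (map (upds v xs cs) xs) bs \<and> v' = upds (upds v xs cs) xs bs)"
    by (auto simp: IH relcomp_unfold)
  also have "\<dots> \<longleftrightarrow> (\<exists>cs bs. length cs = length xs \<and> alpha_rel M xs S1 (map v xs) cs \<and>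
      length bs = length xs \<and> alpha_rel M xs S2 cs bs \<and> v' = upds v xs bs)"
    using assms(1) by (simp add: map_upds upds_upds cong: conj_cong)
  finally show ?case by auto
next
  case (Cond B S1 S2)
  then have "sat M v (fm_of_bexp B) \<longleftrightarrow> sat M (asg M xs (map v xs)) (fm_of_bexp B)"
    by (intro sat_bexp_asg) auto
  with Cond show ?case by auto
next
  case (While B S0)
  then have IH: "(v, v') \<in> xsem M xs S0 \<longleftrightarrow>
      (\<exists>bs. length bs = length xs \<and> alpha_rel M xs S0 (map v xs) bs \<and> v' = upds v xs bs)" for v v'
    by simp
  show ?case
    using xsem_While_imp[OF assms(1) While.prems IH] xsem_While_if[OF assms(1) While.prems IH]
    by blast
qed

lemma g_rel_iff_alpha_rel:
  assumes "distinct xs" "vars_prog S \<subseteq> set xs" "length as = length xs"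
  shows "g_rel M xs S as bs \<longleftrightarrow> length bs = length xs \<and> alpha_rel M xs S as bs"
proof
  assume "g_rel M xs S as bs"
  with assms show "length bs = length xs \<and> alpha_rel M xs S as bs"
    by (auto simp: g_rel_def xsem_iff_alpha_rel map_upds)
next
  \<comment> \<open>Any assignment with values \<open>as\<close> on \<open>xs\<close> would serve as
    the start.\<close>
  let ?v = "asg M xs as"
  assume "length bs = length xs \<and> alpha_rel M xs S as bs"
  moreover have "map ?v xs = as" using assms by (simp add: asg_def map_upds)
  ultimately show "g_rel M xs S as bs"
    unfolding g_rel_def using assms
    by (intro exI[of _ ?v] exI[of _ "upds ?v xs bs"]) (auto simp: xsem_iff_alpha_rel map_upds)
qed

end

theorem theorem4p1p4:
  fixes M :: "'a lstruct" and S :: "nat prog" and xs ys :: "nat list"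
  assumes "countable (UNIV :: 'a set)"
    and "models_PA M"
    and "distinct xs" and "set xs = vars_prog S"
    and "distinct ys" and "length ys = length xs" and "set ys \<inter> set xs = {}"
  shows "(\<forall>as bs cs. g_rel M xs S as bs \<longrightarrow> g_rel M xs S as cs \<longrightarrow> bs = cs) \<and>
    (\<forall>as bs. length as = length xs \<longrightarrow> length bs = length xs \<longrightarrow>
       (g_rel M xs S as bs \<longleftrightarrow> holds M (alpha xs S xs ys) (xs @ ys) (as @ bs)))"
proof -
  interpret PA_model M by unfold_locales fact
  have S: "vars_prog S \<subseteq> set xs" using assms(4) by simp
  have g: "g_rel M xs S as bs \<longleftrightarrow> length bs = length xs \<and> alpha_rel M xs S as bs"
    if "length as = length xs" for as bs
    using g_rel_iff_alpha_rel[OF assms(3) S that] .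
  have "bs = cs" if b: "g_rel M xs S as bs" and c: "g_rel M xs S as cs" for as bs cs
  proof -
    from b have as: "length as = length xs" by (auto simp: g_rel_def)
    from b c show ?thesis
      unfolding g[OF as] using functional_onD[OF functional_on_alpha_rel as] by blast
  qed
  moreover have "g_rel M xs S as bs \<longleftrightarrow> holds M (alpha xs S xs ys) (xs @ ys) (as @ bs)"
    if as: "length as = length xs" and bs: "length bs = length xs" for as bs
  proof -
    \<comment> \<open>As \<open>xs\<close> and \<open>ys\<close> are disjoint, both vectors can be
      read off under every \<open>v\<close>, which removes the quantifier in
      \<open>holds\<close>.\<close>
    have "map (upds v (xs @ ys) (as @ bs)) (xs @ ys) = as @ bs" for v
      using assms as bs by (intro map_upds) auto
    then have "map (upds v (xs @ ys) (as @ bs)) xs = as" "map (upds v (xs @ ys) (as @ bs)) ys = bs"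
      for v using as by (simp_all add: append_eq_append_conv)
    then show ?thesis
      unfolding g[OF as] holds_def using assms(3,6) S bs by (simp add: sat_alpha)
  qed
  ultimately show ?thesis by blast
qed

end
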